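(* Let $(X,\mathcal{T}_1,\ldots,\mathcal{T}_l)$ be a rational dynamical system, where for $1\leq i\leq l$ the family $\mathcal{T}_i$ is defined from the commuting homeomorphisms $\{T_{i,n}\}_{n\in\mathbb{Z}^\ast}$, and let $G$ be the group of homeomorphisms of $X$ generated by all $T_{i,n}$, $n\in\mathbb{Z}^\ast$, $1\leq i\leq l$. Let $Y\subseteq X$. Then $(Y,\mathcal{T}_1|_Y,\ldots,\mathcal{T}_l|_Y)$ is a minimal subsystem of $(X,\mathcal{T}_1,\ldots,\mathcal{T}_l)$ if and only if $Y=\overline{\{S(x): S\in G\}}$ for some uniformly rational recurrent point $x$ of $(X,\mathcal{T}_1,\ldots,\mathcal{T}_l)$.
   Context: Notation: $\mathbb{N}=\{1,2,\ldots\}$, $\mathbb{Z}^\ast=\mathbb{Z}\setminus\{0\}$; $l\in\mathbb{N}$. Expansion of rationals: every rational number $q$ has a unique expression $q=\sum_{s=1}^{\infty}q_{-s}\frac{(-1)^{s}}{(s+1)!}+\sum_{r=1}^{\infty}q_{r}(-1)^{r+1}r!$ with integers $0\leq q_{-s}\leq s$ for $s\geq 1$ and $0\leq q_r\leq r$ for $r\geq 1$, all but finitely many of which are zero. Put $dom(q)=\{t\in\mathbb{Z}^\ast: q_t\neq 0\}$. Rational indexed family: given a family $\{T_n\}_{n\in\mathbb{Z}^\ast}$ of pairwise commuting continuous maps $X\to X$, for a non-zero rational $q$ with $dom(q)=\{t_1<\ldots<t_m\}$ put $\mathcal{T}^q(x)=T_{t_1}^{q_{t_1}}\cdots T_{t_m}^{q_{t_m}}(x)$,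 and put $\mathcal{T}^0(x)=x$. Then $\mathcal{T}=(\mathcal{T}^q)_{q\in\mathbb{Q}}$ is the rational indexed family defined from $\{T_n\}_{n\in\mathbb{Z}^\ast}$. Rational dynamical system: $(X,\mathcal{T}_1,\ldots,\mathcal{T}_l)$ where $X$ is a non-empty compact metric space and, for $1\leq i\leq l$, $\mathcal{T}_i$ is the rational indexed family defined from a family $\{T_{i,n}\}_{n\in\mathbb{Z}^\ast}$ of homeomorphisms of $X$ onto itself, such that $T_{i,n_1}T_{j,n_2}=T_{j,n_2}T_{i,n_1}$ for all $1\leq i,j\leq l$ and $n_1,n_2\in\mathbb{Z}^\ast$. It is minimal if every closed $Y\subseteq X$ with $T_{i,n}(Y)=Y$ for all $1\leq i\leq l$, $n\in\mathbb{Z}^\ast$ satisfies $Y=X$ or $Y=\emptyset$. Subsystem: for $Y\subseteq X$ non-empty, $(Y,\mathcal{T}_1|_Y,\ldots,\mathcal{T}_l|_Y)$ is a subsystem of $(X,\mathcal{T}_1,\ldots,\mathcal{T}_l)$ if $Y$ is closed in $X$ and $T_{i,n}(Y)=Y$ for all $1\leq i\leq l$, $n\in\mathbb{Z}^\ast$; it is a minimal subsystem if it is moreover minimal as a rational dynamical system. Syndetic: a subset $E$ of an abelian (semi)group $(G,+)$ is syndetic if there is a non-empty finite $F\subseteq G$ with $G=\bigcup_{g\in F}\{s\in G: g+s\in E\}$. Uniformly rational recurrent: a point $x\in X$ is uniformly rational recurrent for $(X,\mathcal{T}_1,\ldots,\mathcal{T}_l)$ if for every neighborhood $V$ of $x$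 the set $\{S\in G: S(x)\in V\}$ is syndetic in the (abelian) group $G$ (with composition as operation). *)

theory Defs
  imports "HOL-Analysis.Analysis" "HOL-Algebra.Bij" "HOL-Algebra.Generated_Groups"
begin

definition nonzero_ints :: "int set" where
  "nonzero_ints = UNIV - {0}"

text \<open>The digits \<open>c t\<close> are indexed by the non-zero integers; the value at \<open>0\<close> is
  fixed to be \<open>0\<close> so that the digit function of a rational is unique.  Both series have
  finitely many non-zero terms and are written as finite sums over the support.\<close>

definition is_rat_expansion :: "rat \<Rightarrow> (int \<Rightarrow> nat) \<Rightarrow> bool" where
  "is_rat_expansion q c \<longleftrightarrow>
     c 0 = 0 \<and>
     (\<forall>s\<ge>1. c (- int s) \<le> s) \<and> (\<forall>r\<ge>1. c (int r) \<le> r) \<and>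
     finite {t. c t \<noteq> 0} \<and>
     q = (\<Sum>s | s \<ge> 1 \<and> c (- int s) \<noteq> 0. of_nat (c (- int s)) * ((- 1) ^ s / fact (s + 1)))
       + (\<Sum>r | r \<ge> 1 \<and> c (int r) \<noteq> 0. of_nat (c (int r)) * (- 1) ^ (r + 1) * fact r)"

definition rat_digit :: "rat \<Rightarrow> int \<Rightarrow> nat" where
  "rat_digit q = (THE c. is_rat_expansion q c)"

definition rat_dom :: "rat \<Rightarrow> int set" where
  "rat_dom q = {t \<in> nonzero_ints. rat_digit q t \<noteq> 0}"

definition rational_indexed_family :: "(int \<Rightarrow> 'a \<Rightarrow> 'a) \<Rightarrow> rat \<Rightarrow> 'a \<Rightarrow> 'a" where
  "rational_indexed_family T q =
     (if q = 0 then id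
      else foldr (\<lambda>t f. (T t ^^ rat_digit q t) \<circ> f) (sorted_list_of_set (rat_dom q)) id)"

text \<open>The space is a subset \<open>X\<close> of a metric space type.  The maps \<open>T i n\<close> and
  \<open>\<T> i q\<close> are only relevant for \<open>1 \<le> i \<le> l\<close>, \<open>n \<noteq> 0\<close>, and on \<open>X\<close>.\<close>

definition rational_dynamical_system ::
  "'a::metric_space set \<Rightarrow> nat \<Rightarrow> (nat \<Rightarrow> int \<Rightarrow> 'a \<Rightarrow> 'a) \<Rightarrow> (nat \<Rightarrow> rat \<Rightarrow> 'a \<Rightarrow> 'a) \<Rightarrow> bool" where
  "rational_dynamical_system X l T \<T> \<longleftrightarrow>
     l \<ge> 1 \<and> X \<noteq> {} \<and> compact X \<and>
     (\<forall>i\<in>{1..l}. \<forall>n\<in>nonzero_ints. \<exists>g. homeomorphism X X (T i n) g) \<and>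
     (\<forall>i\<in>{1..l}. \<forall>j\<in>{1..l}. \<forall>n\<in>nonzero_ints. \<forall>m\<in>nonzero_ints. \<forall>x\<in>X.
        T i n (T j m x) = T j m (T i n x)) \<and>
     (\<forall>i\<in>{1..l}. \<forall>q. \<forall>x\<in>X. \<T> i q x = rational_indexed_family (T i) q x)"

definition minimal_system ::
  "'a::metric_space set \<Rightarrow> nat \<Rightarrow> (nat \<Rightarrow> int \<Rightarrow> 'a \<Rightarrow> 'a) \<Rightarrow> (nat \<Rightarrow> rat \<Rightarrow> 'a \<Rightarrow> 'a) \<Rightarrow> bool" where
  "minimal_system X l T \<T> \<longleftrightarrow>
     rational_dynamical_system X l T \<T> \<and>
     (\<forall>Z. closedin (top_of_set X) Z \<and> (\<forall>i\<in>{1..l}. \<forall>n\<in>nonzero_ints. T i n ` Z = Z)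
        \<longrightarrow> Z = X \<or> Z = {})"

definition subsystem ::
  "'a::metric_space set \<Rightarrow> 'a set \<Rightarrow> nat \<Rightarrow> (nat \<Rightarrow> int \<Rightarrow> 'a \<Rightarrow> 'a) \<Rightarrow> bool" where
  "subsystem Y X l T \<longleftrightarrow>
     Y \<noteq> {} \<and> closedin (top_of_set X) Y \<and> (\<forall>i\<in>{1..l}. \<forall>n\<in>nonzero_ints. T i n ` Y = Y)"

definition minimal_subsystem ::
  "'a::metric_space set \<Rightarrow> 'a set \<Rightarrow> nat \<Rightarrow> (nat \<Rightarrow> int \<Rightarrow> 'a \<Rightarrow> 'a) \<Rightarrow> (nat \<Rightarrow> rat \<Rightarrow> 'a \<Rightarrow> 'a) \<Rightarrow> bool"
  where
  "minimal_subsystem Y X l T \<T> \<longleftrightarrow>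
     subsystem Y X l T \<and>
     minimal_system Y l (\<lambda>i n. restrict (T i n) Y) (\<lambda>i q. restrict (\<T> i q) Y)"

text \<open>The subgroup of \<open>BijGroup X\<close> (bijections of \<open>X\<close>, made extensional) generated by the
  \<open>T i n\<close>.  In a rational dynamical system the generators are homeomorphisms of \<open>X\<close>, and
  hence so are all elements.\<close>

definition system_group ::
  "'a set \<Rightarrow> nat \<Rightarrow> (nat \<Rightarrow> int \<Rightarrow> 'a \<Rightarrow> 'a) \<Rightarrow> ('a \<Rightarrow> 'a) monoid" where
  "system_group X l T =
     (BijGroup X)\<lparr>carrier :=
        generate (BijGroup X) {restrict (T i n) X | i n. i \<in> {1..l} \<and> n \<in> nonzero_ints}\<rparr>"

definition syndetic :: "('g, 'm) monoid_scheme \<Rightarrow> 'g set \<Rightarrow> bool" where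
  "syndetic G E \<longleftrightarrow>
     E \<subseteq> carrier G \<and>
     (\<exists>F. finite F \<and> F \<noteq> {} \<and> F \<subseteq> carrier G \<and>
        carrier G = (\<Union>g\<in>F. {s \<in> carrier G. g \<otimes>\<^bsub>G\<^esub> s \<in> E}))"

definition uniformly_rational_recurrent ::
  "'a::metric_space set \<Rightarrow> nat \<Rightarrow> (nat \<Rightarrow> int \<Rightarrow> 'a \<Rightarrow> 'a) \<Rightarrow> 'a \<Rightarrow> bool" where
  "uniformly_rational_recurrent X l T x \<longleftrightarrow>
     x \<in> X \<and>
     (\<forall>V. V \<subseteq> X \<and> (\<exists>U. openin (top_of_set X) U \<and> x \<in> U \<and> U \<subseteq> V) \<longrightarrow>
        syndetic (system_group X l T) {S \<in> carrier (system_group X l T). S x \<in> V})"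

end

theory Submission imports Defs begin

text \<open>Every non-empty closed invariant subset of a minimal \<open>Y\<close> is all of \<open>Y\<close>, so every \<open>G\<close>-orbit in
  \<open>Y\<close> is dense in \<open>Y\<close> and meets each neighbourhood \<open>U\<close> of a given \<open>x \<in> Y\<close>.  Hence the preimages
  \<open>S\<inverse>(U)\<close> cover \<open>Y\<close>, and a finite subcover witnesses that the return times of \<open>x\<close> are syndetic.
  Conversely, if a closed invariant set \<open>Z\<close> in the orbit closure of a uniformly recurrent \<open>x\<close> missed \<open>x\<close>,
  take a closed ball \<open>B\<close> about \<open>x\<close> disjoint from \<open>Z\<close>; syndeticity covers the orbit, and
  therefore its closure, by finitely many closed preimages \<open>g\<inverse>(B)\<close>, none of which meets \<open>Z\<close>.\<close>

section \<open>The group generated by the maps and its action on \<open>X\<close>\<close>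

lemma rational_dynamical_systemD:
  assumes "rational_dynamical_system X l T \<T>"
  shows "X \<noteq> {}" "compact X"
    and "\<And>i n. i \<in> {1..l} \<Longrightarrow> n \<in> nonzero_ints \<Longrightarrow> \<exists>g. homeomorphism X X (T i n) g"
  using assms unfolding rational_dynamical_system_def by auto

lemma homeomorphism_imp_restrict_Bij:
  assumes "homeomorphism X X f g"
  shows "restrict f X \<in> Bij X"
proof -
  have "bij_betw f X X"
    using assms by (intro bij_betw_byWitness[of X g]) (auto simp: homeomorphism_def)
  then show ?thesis
    using bij_betw_cong[of X "restrict f X" f X] by (simp add: Bij_def)
qed

text \<open>Identifies the abstract inverses that \<open>generate\<close> adds with concrete maps,
  so that the continuity of \<open>g\<close> and its cancellation laws become available. A left
  inverse suffices in a group.\<close>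

lemma inv_BijGroup_homeomorphism:
  assumes "homeomorphism X X f g"
  shows "inv\<^bsub>BijGroup X\<^esub> (restrict f X) = restrict g X"
proof -
  interpret group "BijGroup X" by (rule group_BijGroup)
  have f: "restrict f X \<in> Bij X" and g: "restrict g X \<in> Bij X"
    using assms homeomorphism_imp_restrict_Bij homeomorphism_symD by blast+
  have "restrict g X \<otimes>\<^bsub>BijGroup X\<^esub> restrict f X = \<one>\<^bsub>BijGroup X\<^esub>"
    using assms f g by (auto simp: BijGroup_def compose_def homeomorphism_def fun_eq_iff restrict_def)
  then show ?thesis
    using f g by (intro inv_equality) (auto simp: BijGroup_def)
qed

lemma system_generators_subset:
  assumes "rational_dynamical_system X l T \<T>"
  shows "{restrict (T i n) X | i n. i \<in> {1..l} \<and> n \<in> nonzero_ints} \<subseteq> carrier (BijGroup X)"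
  using rational_dynamical_systemD(3)[OF assms] homeomorphism_imp_restrict_Bij
  by (auto simp: BijGroup_def) blast

lemma system_group_subset_Bij:
  assumes "rational_dynamical_system X l T \<T>"
  shows "carrier (system_group X l T) \<subseteq> Bij X"
  using group.generate_incl[OF group_BijGroup system_generators_subset[OF assms]]
  by (simp add: system_group_def BijGroup_def)

lemma system_group_generator:
  assumes "i \<in> {1..l}" "n \<in> nonzero_ints"
  shows "restrict (T i n) X \<in> carrier (system_group X l T)"
  using assms unfolding system_group_def by (auto intro: generate.incl)

lemma system_group_generator_inv:
  assumes "i \<in> {1..l}" "n \<in> nonzero_ints" "homeomorphism X X (T i n) g"
  shows "restrict g X \<in> carrier (system_group X l T)"
proof -
  have "restrict (T i n) X \<in> {restrict (T i n) X | i n. i \<in> {1..l} \<and> n \<in> nonzero_ints}"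
    using assms by blast
  from generate.inv[OF this, of "BijGroup X"] show ?thesis
    by (simp add: system_group_def inv_BijGroup_homeomorphism[OF assms(3)])
qed

lemma system_group_id: "restrict id X \<in> carrier (system_group X l T)"
  using generate.one[of "BijGroup X"] unfolding system_group_def
  by (auto simp: BijGroup_def id_def)

lemma system_group_mult:
  assumes "rational_dynamical_system X l T \<T>"
    and "R \<in> carrier (system_group X l T)" "S \<in> carrier (system_group X l T)"
  shows "R \<otimes>\<^bsub>system_group X l T\<^esub> S = compose X R S"
    and "compose X R S \<in> carrier (system_group X l T)"
proof -
  have "R \<in> Bij X" "S \<in> Bij X"
    using assms system_group_subset_Bij by blast+
  then have eq: "R \<otimes>\<^bsub>BijGroup X\<^esub> S = compose X R S"
    by (simp add: BijGroup_def)
  then show "R \<otimes>\<^bsub>system_group X l T\<^esub> S = compose X R S"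
    by (simp add: system_group_def)
  show "compose X R S \<in> carrier (system_group X l T)"
    using assms(2,3) unfolding system_group_def eq[symmetric] by (auto intro: generate.eng)
qed

text \<open>Recasts induction over \<open>generate\<close> in terms of maps: an inverse generator
  appears as a restricted inverse homeomorphism, and the group product as \<open>compose X\<close>.
  It serves to carry properties of the generators over to the whole group.\<close>

lemma system_group_induct [consumes 2, case_names id generator inverse compose]:
  assumes sys: "rational_dynamical_system X l T \<T>"
    and S: "S \<in> carrier (system_group X l T)"
    and id: "P (restrict id X)"
    and generator: "\<And>i n. i \<in> {1..l} \<Longrightarrow> n \<in> nonzero_ints \<Longrightarrow> P (restrict (T i n) X)"
    and inverse: "\<And>i n g. i \<in> {1..l} \<Longrightarrow> n \<in> nonzero_ints \<Longrightarrow>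
      homeomorphism X X (T i n) g \<Longrightarrow> P (restrict g X)"
    and compose: "\<And>R S. R \<in> Bij X \<Longrightarrow> S \<in> Bij X \<Longrightarrow> P R \<Longrightarrow> P S \<Longrightarrow> P (compose X R S)"
  shows "P S"
proof -
  let ?A = "{restrict (T i n) X | i n. i \<in> {1..l} \<and> n \<in> nonzero_ints}"
  have sub: "generate (BijGroup X) ?A \<subseteq> Bij X"
    using system_group_subset_Bij[OF sys] by (simp add: system_group_def)
  have "S \<in> generate (BijGroup X) ?A"
    using S by (simp add: system_group_def)
  then show ?thesis
  proof (induction S rule: generate.induct)
    case one
    then show ?case using id by (simp add: BijGroup_def restrict_def id_def)
  next
    case (incl h)
    then show ?case using generator by blast
  next
    case (inv h)
    then obtain i n where h: "i \<in> {1..l}" "n \<in> nonzero_ints" "h = restrict (T i n) X"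
      by blast
    then obtain g where "homeomorphism X X (T i n) g"
      using rational_dynamical_systemD(3)[OF sys] by blast
    then show ?case using h inverse inv_BijGroup_homeomorphism by metis
  next
    case (eng h1 h2)
    then have "h1 \<in> Bij X" "h2 \<in> Bij X" using sub by blast+
    then show ?case using compose eng by (simp add: BijGroup_def)
  qed
qed

text \<open>Identity, inverses and composites of homeomorphisms are homeomorphisms. The elements of
  the group are given only as bijections, and this is where their continuity comes from.\<close>

lemma system_group_homeomorphism:
  assumes "rational_dynamical_system X l T \<T>" "S \<in> carrier (system_group X l T)"
  shows "\<exists>g. homeomorphism X X S g"
  using assms
proof (induction rule: system_group_induct)
  case id
  have "homeomorphism X X (restrict id X) (\<lambda>x. x)"
    by (rule homeomorphism_cong[OF homeomorphism_ident]) auto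
  then show ?case by blast
next
  case (generator i n)
  then obtain g where g: "homeomorphism X X (T i n) g"
    using rational_dynamical_systemD(3)[OF assms(1)] by blast
  have "homeomorphism X X (restrict (T i n) X) g"
    by (rule homeomorphism_cong[OF g]) auto
  then show ?case by blast
next
  case (inverse i n g)
  have "homeomorphism X X (restrict g X) (T i n)"
    by (rule homeomorphism_cong[OF homeomorphism_symD[OF inverse(3)]]) auto
  then show ?case by blast
next
  case (compose R S)
  then obtain f g where "homeomorphism X X R f" "homeomorphism X X S g" by blast
  then have "homeomorphism X X (R \<circ> S) (g \<circ> f)"
    using homeomorphism_compose by blast
  then have "homeomorphism X X (compose X R S) (g \<circ> f)"
    by (rule homeomorphism_cong) (auto simp: compose_def)
  then show ?case by blast
qed

lemma system_group_in_space:
  assumes "rational_dynamical_system X l T \<T>" "S \<in> carrier (system_group X l T)" "x \<in> X"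
  shows "S x \<in> X"
  using system_group_homeomorphism[OF assms(1,2)] assms(3) unfolding homeomorphism_def by blast

lemma system_group_continuous_on:
  assumes "rational_dynamical_system X l T \<T>" "S \<in> carrier (system_group X l T)"
  shows "continuous_on X S"
  using system_group_homeomorphism[OF assms] unfolding homeomorphism_def by blast

lemma system_group_image_invariant:
  assumes "rational_dynamical_system X l T \<T>" "S \<in> carrier (system_group X l T)"
    and Z: "Z \<subseteq> X" and inv: "\<And>i n. i \<in> {1..l} \<Longrightarrow> n \<in> nonzero_ints \<Longrightarrow> T i n ` Z = Z"
  shows "S ` Z = Z"
  using assms(1,2)
proof (induction rule: system_group_induct)
  case id
  show ?case using Z by auto
next
  case (generator i n)
  have "restrict (T i n) X ` Z = T i n ` Z"
    using Z by (intro image_cong) auto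
  then show ?case using inv[OF generator] by simp
next
  case (inverse i n g)
  have "restrict g X ` Z = g ` T i n ` Z"
    using Z inv[OF inverse(1,2)] by (auto intro!: image_cong)
  also have "\<dots> = (\<lambda>x. x) ` Z"
    unfolding image_image using inverse(3) Z by (intro image_cong) (auto simp: homeomorphism_def)
  finally show ?case by simp
next
  case (compose R S)
  have "compose X R S ` Z = R ` S ` Z"
    unfolding image_image using Z by (intro image_cong) (auto simp: compose_def)
  then show ?case using compose by simp
qed

section \<open>Orbits and their closures\<close>

definition system_orbit :: "'a set \<Rightarrow> nat \<Rightarrow> (nat \<Rightarrow> int \<Rightarrow> 'a \<Rightarrow> 'a) \<Rightarrow> 'a \<Rightarrow> 'a set" where
  "system_orbit X l T x = {S x | S. S \<in> carrier (system_group X l T)}"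

lemma system_orbit_self: "x \<in> X \<Longrightarrow> x \<in> system_orbit X l T x"
  unfolding system_orbit_def using system_group_id[of X l T] by (auto intro!: exI[of _ "restrict id X"])

lemma system_orbit_subset:
  assumes "rational_dynamical_system X l T \<T>"
    and "Z \<subseteq> X" "\<And>i n. i \<in> {1..l} \<Longrightarrow> n \<in> nonzero_ints \<Longrightarrow> T i n ` Z = Z" "x \<in> Z"
  shows "system_orbit X l T x \<subseteq> Z"
  using system_group_image_invariant[OF assms(1) _ assms(2,3)] assms(4)
  unfolding system_orbit_def by blast

lemma system_orbit_in_space:
  assumes "rational_dynamical_system X l T \<T>" "x \<in> X"
  shows "system_orbit X l T x \<subseteq> X"
  using system_group_in_space[OF assms(1)] assms(2) unfolding system_orbit_def by blast

text \<open>Composing on the left with a generator or with its inverse stays in the group, so both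
  maps send the orbit into itself; together this gives equality of the image.\<close>

lemma system_orbit_invariant:
  assumes sys: "rational_dynamical_system X l T \<T>" and "x \<in> X" "i \<in> {1..l}" "n \<in> nonzero_ints"
  shows "T i n ` system_orbit X l T x = system_orbit X l T x"
proof -
  let ?O = "system_orbit X l T x"
  \<comment> \<open>With \<open>R\<close> arbitrary, one fact serves both \<open>T i n\<close> and
    its inverse \<open>g\<close>.\<close>
  have closed: "restrict R X y \<in> ?O" if R: "restrict R X \<in> carrier (system_group X l T)" and y: "y \<in> ?O" for R y
  proof -
    obtain S where S: "S \<in> carrier (system_group X l T)" "y = S x"
      using y unfolding system_orbit_def by blast
    then have "restrict R X y = compose X (restrict R X) S x"
      using \<open>x \<in> X\<close> by (simp add: compose_def)
    then show ?thesis
      using system_group_mult(2)[OF sys R S(1)] unfolding system_orbit_def by blast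
  qed
  obtain g where g: "homeomorphism X X (T i n) g"
    using rational_dynamical_systemD(3)[OF sys] assms by blast
  have OX: "y \<in> X" if "y \<in> ?O" for y
    using system_orbit_in_space[OF sys \<open>x \<in> X\<close>] that by blast
  have *: "T i n y \<in> ?O" "g y \<in> ?O" "y = T i n (g y)" if "y \<in> ?O" for y
    using closed[OF system_group_generator that] closed[OF system_group_generator_inv that] assms g
      OX[OF that] by (auto simp: homeomorphism_def)
  show ?thesis
    \<comment> \<open>For surjectivity the preimage of \<open>y\<close> is \<open>g y\<close>, which
      lies in the orbit again.\<close>
    using *(1) by (auto intro: image_eqI[where f = "T i n", OF *(3) *(2)])
qed

text \<open>Continuity gives one inclusion. For the other, the image of the compact set
  \<open>closure A\<close> is compact, hence closed, and it contains \<open>A\<close>.\<close>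

lemma homeomorphism_image_closure:
  fixes X :: "'a::metric_space set"
  assumes hom: "homeomorphism X X f g" and "compact X" and "A \<subseteq> X" "f ` A = A"
  shows "f ` closure A = closure A"
proof -
  have cl: "closure A \<subseteq> X"
    using assms compact_imp_closed closure_minimal by blast
  then have cont: "continuous_on (closure A) f"
    using hom continuous_on_subset homeomorphism_def by metis
  have "compact (closure A)"
    using \<open>compact X\<close> cl compact_Int_closed[of X "closure A"] by (simp add: Int_absorb1)
  then have "closed (f ` closure A)"
    using cont compact_continuous_image compact_imp_closed by blast
  moreover have "A \<subseteq> f ` closure A"
    using \<open>f ` A = A\<close> closure_subset by blast
  ultimately have "closure A \<subseteq> f ` closure A"
    by (simp add: closure_minimal)
  moreover have "f ` closure A \<subseteq> closure A"
    using cont \<open>f ` A = A\<close> closure_subset[of A] by (intro image_closure_subset) auto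
  ultimately show ?thesis by blast
qed

text \<open>Provides the closed invariant sets against which minimality is tested, and the candidate
  for \<open>Y\<close> in the converse direction.\<close>

lemma subsystem_orbit_closure:
  assumes sys: "rational_dynamical_system X l T \<T>" and "x \<in> X"
  shows "subsystem (closure (system_orbit X l T x)) X l T"
proof -
  let ?O = "system_orbit X l T x"
  have "?O \<subseteq> X" using system_orbit_in_space assms by blast
  then have "closure ?O \<subseteq> X"
    using rational_dynamical_systemD(2)[OF sys] compact_imp_closed closure_minimal by blast
  then have "closedin (top_of_set X) (closure ?O)"
    by (simp add: closed_subset)
  moreover have "closure ?O \<noteq> {}"
    using system_orbit_self[OF \<open>x \<in> X\<close>, of l T] by auto
  moreover have "T i n ` closure ?O = closure ?O" if in_range: "i \<in> {1..l}" "n \<in> nonzero_ints" for i n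
  proof -
    obtain g where "homeomorphism X X (T i n) g"
      using rational_dynamical_systemD(3)[OF sys] in_range by blast
    then show ?thesis
      using homeomorphism_image_closure rational_dynamical_systemD(2)[OF sys] \<open>?O \<subseteq> X\<close>
        system_orbit_invariant[OF sys \<open>x \<in> X\<close> in_range] by blast
  qed
  ultimately show ?thesis unfolding subsystem_def by blast
qed

section \<open>Restriction to a subsystem, and minimality in terms of \<open>X\<close> alone\<close>

lemma funpow_restrict:
  assumes "f ` Y \<subseteq> Y" "y \<in> Y"
  shows "(restrict f Y ^^ k) y = (f ^^ k) y \<and> (f ^^ k) y \<in> Y"
  using assms by (induction k) auto

lemma rational_indexed_family_restrict:
  assumes inv: "\<And>n. n \<in> nonzero_ints \<Longrightarrow> T n ` Y \<subseteq> Y" and "y \<in> Y"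
  shows "rational_indexed_family (\<lambda>n. restrict (T n) Y) q y = rational_indexed_family T q y"
proof -
  \<comment> \<open>The second conjunct strengthens the induction: a restricted factor agrees with
    the original one only at points of \<open>Y\<close>, so the intermediate values must be known to
    stay there.\<close>
  have *: "foldr (\<lambda>t f. (restrict (T t) Y ^^ d t) \<circ> f) ts id y = foldr (\<lambda>t f. (T t ^^ d t) \<circ> f) ts id y
      \<and> foldr (\<lambda>t f. (T t ^^ d t) \<circ> f) ts id y \<in> Y"
    if "set ts \<subseteq> nonzero_ints" for ts and d :: "int \<Rightarrow> nat"
    using that by (induction ts) (use \<open>y \<in> Y\<close> funpow_restrict[OF inv] in auto)
  have "set (sorted_list_of_set (rat_dom q)) \<subseteq> nonzero_ints"
    \<comment> \<open>For an infinite set \<open>sorted_list_of_set\<close> returns the empty list,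
      so the inclusion holds without first proving that the support is finite.\<close>
    by (cases "finite (rat_dom q)") (auto simp: rat_dom_def)
  then show ?thesis
    using * unfolding rational_indexed_family_def by auto
qed

text \<open>Since each \<open>T i n\<close> maps \<open>Y\<close> onto \<open>Y\<close>, its inverse
  does too, and every defining condition passes to \<open>Y\<close>. Thus the first half of
  \<open>minimal_system\<close> is automatic for a subsystem.\<close>

lemma rational_dynamical_system_restrict:
  assumes sys: "rational_dynamical_system X l T \<T>" and sub: "subsystem Y X l T"
  shows "rational_dynamical_system Y l (\<lambda>i n. restrict (T i n) Y) (\<lambda>i q. restrict (\<T> i q) Y)"
proof -
  have "compact X" using rational_dynamical_systemD[OF sys] by simp
  have YX: "Y \<subseteq> X" and "Y \<noteq> {}" and "closedin (top_of_set X) Y"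
    and inv: "\<And>i n. i \<in> {1..l} \<Longrightarrow> n \<in> nonzero_ints \<Longrightarrow> T i n ` Y = Y"
    using sub closedin_imp_subset unfolding subsystem_def by auto
  then have "compact Y"
    using \<open>compact X\<close> closedin_compact by blast
  have hom: "\<exists>g. homeomorphism Y Y (restrict (T i n) Y) g" if in_range: "i \<in> {1..l}" "n \<in> nonzero_ints" for i n
  proof -
    obtain g where "homeomorphism X X (T i n) g"
      using rational_dynamical_systemD(3)[OF sys] in_range by blast
    then have "homeomorphism Y Y (T i n) g"
      using YX inv[OF in_range] by (blast intro: homeomorphism_of_subsets)
    then have "homeomorphism Y Y (restrict (T i n) Y) g"
      by (rule homeomorphism_cong) auto
    then show ?thesis by blast
  qed
  have mem: "T i n y \<in> Y" if "i \<in> {1..l}" "n \<in> nonzero_ints" "y \<in> Y" for i n y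
    using inv that by blast
  have fam: "restrict (\<T> i q) Y y = rational_indexed_family (\<lambda>n. restrict (T i n) Y) q y"
    if "i \<in> {1..l}" "y \<in> Y" for i q y
  proof -
    have "\<T> i q y = rational_indexed_family (T i) q y"
      using sys that YX unfolding rational_dynamical_system_def by blast
    then show ?thesis
      using rational_indexed_family_restrict[of "T i" Y y q] inv that by auto
  qed
  have comm: "restrict (T i n) Y (restrict (T j m) Y y) = restrict (T j m) Y (restrict (T i n) Y y)"
    if "i \<in> {1..l}" "j \<in> {1..l}" "n \<in> nonzero_ints" "m \<in> nonzero_ints" "y \<in> Y" for i j n m y
  proof -
    have "T i n (T j m y) = T j m (T i n y)"
      using sys that YX unfolding rational_dynamical_system_def by blast
    then show ?thesis using mem that by simp
  qed
  have "l \<ge> 1" using sys unfolding rational_dynamical_system_def by blast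
  with \<open>Y \<noteq> {}\<close> \<open>compact Y\<close> show ?thesis
    unfolding rational_dynamical_system_def by (intro conjI ballI allI hom fam comm)
qed

text \<open>Removes the restricted maps from minimality. As \<open>Y\<close> is closed in
  \<open>X\<close>, closedness in \<open>Y\<close> of a subset of \<open>Y\<close> is closedness in
  \<open>X\<close>, and restricting a map to \<open>Y\<close> does not change images of subsets of
  \<open>Y\<close>. The alternative \<open>Z = {}\<close> is absorbed by the non-emptiness in
  \<open>subsystem\<close>.\<close>

lemma minimal_subsystem_iff:
  assumes sys: "rational_dynamical_system X l T \<T>"
  shows "minimal_subsystem Y X l T \<T> \<longleftrightarrow>
    subsystem Y X l T \<and> (\<forall>Z \<subseteq> Y. subsystem Z X l T \<longrightarrow> Z = Y)"
proof (cases "subsystem Y X l T")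
  case True
  then have Y: "closedin (top_of_set X) Y" and YX: "Y \<subseteq> X"
    using closedin_imp_subset unfolding subsystem_def by auto
  have closed_iff: "closedin (top_of_set Y) Z \<longleftrightarrow> Z \<subseteq> Y \<and> closedin (top_of_set X) Z" for Z
  proof
    assume "closedin (top_of_set Y) Z"
    then show "Z \<subseteq> Y \<and> closedin (top_of_set X) Z"
      using Y closedin_imp_subset closedin_trans by metis
  next
    assume "Z \<subseteq> Y \<and> closedin (top_of_set X) Z"
    then show "closedin (top_of_set Y) Z"
      using YX closedin_subset_trans by blast
  qed
  have image: "restrict (T i n) Y ` Z = T i n ` Z" if "Z \<subseteq> Y" for i n Z
    using that by (intro image_cong) auto
  have "minimal_subsystem Y X l T \<T> \<longleftrightarrow>
      (\<forall>Z. closedin (top_of_set Y) Z \<and>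
        (\<forall>i\<in>{1..l}. \<forall>n\<in>nonzero_ints. restrict (T i n) Y ` Z = Z) \<longrightarrow> Z = Y \<or> Z = {})"
    using True rational_dynamical_system_restrict[OF sys True]
    unfolding minimal_subsystem_def minimal_system_def by blast
  also have "\<dots> \<longleftrightarrow> (\<forall>Z. Z \<subseteq> Y \<longrightarrow> subsystem Z X l T \<longrightarrow> Z = Y)"
  proof (intro arg_cong[of _ _ All] ext)
    fix Z
    show "(closedin (top_of_set Y) Z \<and>
        (\<forall>i\<in>{1..l}. \<forall>n\<in>nonzero_ints. restrict (T i n) Y ` Z = Z) \<longrightarrow> Z = Y \<or> Z = {}) \<longleftrightarrow>
        (Z \<subseteq> Y \<longrightarrow> subsystem Z X l T \<longrightarrow> Z = Y)"
      unfolding closed_iff subsystem_def using image[of Z] by (cases "Z \<subseteq> Y") auto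
  qed
  finally show ?thesis using True by simp
qed (simp add: minimal_subsystem_def)

section \<open>Minimality and uniform recurrence\<close>

lemma minimal_subsystem_orbit_closure:
  assumes sys: "rational_dynamical_system X l T \<T>" and min: "minimal_subsystem Y X l T \<T>" and "y \<in> Y"
  shows "closure (system_orbit X l T y) = Y"
proof -
  have "subsystem Y X l T" and least: "\<And>Z. Z \<subseteq> Y \<Longrightarrow> subsystem Z X l T \<Longrightarrow> Z = Y"
    using min minimal_subsystem_iff[OF sys] by auto
  then have "Y \<subseteq> X" "closedin (top_of_set X) Y"
    and inv: "\<And>i n. i \<in> {1..l} \<Longrightarrow> n \<in> nonzero_ints \<Longrightarrow> T i n ` Y = Y"
    using closedin_imp_subset[of euclidean X Y] unfolding subsystem_def by blast+
  then have "closed Y"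
    using rational_dynamical_systemD(2)[OF sys] closedin_compact compact_imp_closed by blast
  then have "closure (system_orbit X l T y) \<subseteq> Y"
    using system_orbit_subset[OF sys \<open>Y \<subseteq> X\<close> inv \<open>y \<in> Y\<close>] by (simp add: closure_minimal)
  \<comment> \<open>The orbit closure is itself a subsystem contained in \<open>Y\<close>, so
    minimality forces equality.\<close>
  then show ?thesis
    using least subsystem_orbit_closure[OF sys] \<open>y \<in> Y\<close> \<open>Y \<subseteq> X\<close> by blast
qed

lemma minimal_subsystem_imp_recurrent:
  assumes sys: "rational_dynamical_system X l T \<T>" and min: "minimal_subsystem Y X l T \<T>" and "x \<in> Y"
  shows "uniformly_rational_recurrent X l T x"
  unfolding uniformly_rational_recurrent_def
proof (intro conjI allI impI)
  let ?G = "system_group X l T"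
  have "subsystem Y X l T" using min by (simp add: minimal_subsystem_def)
  then have YX: "Y \<subseteq> X" and Y: "closedin (top_of_set X) Y"
    and inv: "\<And>i n. i \<in> {1..l} \<Longrightarrow> n \<in> nonzero_ints \<Longrightarrow> T i n ` Y = Y"
    using closedin_imp_subset unfolding subsystem_def by auto
  then show "x \<in> X" using \<open>x \<in> Y\<close> by blast
  fix V assume "V \<subseteq> X \<and> (\<exists>U. openin (top_of_set X) U \<and> x \<in> U \<and> U \<subseteq> V)"
  then obtain W where "open W" "x \<in> W" and WV: "X \<inter> W \<subseteq> V"
    unfolding openin_open by blast
  have "compact Y"
    using Y rational_dynamical_systemD(2)[OF sys] closedin_compact by blast
  \<comment> \<open>Continuity of \<open>S\<close> is known only on \<open>X\<close>, so its
    preimages are open relative to \<open>Y\<close>; compactness is therefore used below for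
    relatively open covers.\<close>
  moreover have "openin (top_of_set Y) (Y \<inter> S -` W)" if "S \<in> carrier ?G" for S
    using system_group_continuous_on[OF sys that] YX \<open>open W\<close>
    by (blast intro: continuous_openin_preimage_gen continuous_on_subset)
  moreover have "Y \<subseteq> (\<Union>S\<in>carrier ?G. Y \<inter> S -` W)"
  proof
    fix y assume "y \<in> Y"
    then have "x \<in> closure (system_orbit X l T y)"
      using minimal_subsystem_orbit_closure[OF sys min] \<open>x \<in> Y\<close> by blast
    then have "W \<inter> system_orbit X l T y \<noteq> {}"
      using \<open>open W\<close> \<open>x \<in> W\<close> open_Int_closure_eq_empty by blast
    then show "y \<in> (\<Union>S\<in>carrier ?G. Y \<inter> S -` W)"
      using \<open>y \<in> Y\<close> unfolding system_orbit_def by blast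
  qed
  ultimately have "\<exists>\<D> \<subseteq> (\<lambda>S. Y \<inter> S -` W) ` carrier ?G. finite \<D> \<and> Y \<subseteq> \<Union>\<D>"
    unfolding compact_eq_openin_cover by (elim allE[of _ "(\<lambda>S. Y \<inter> S -` W) ` carrier ?G"]) auto
  \<comment> \<open>Choosing one group element for each member of the subcover yields the finite set
    of translations required by \<open>syndetic\<close>.\<close>
  then obtain F where F: "finite F" "F \<subseteq> carrier ?G" "Y \<subseteq> (\<Union>S\<in>F. Y \<inter> S -` W)"
    using finite_subset_image[of _ "\<lambda>S. Y \<inter> S -` W"] by metis
  \<comment> \<open>The cover is applied to the moved point \<open>s x\<close>, which is still in
    \<open>Y\<close>: the \<open>g\<close> whose preimage contains it brings it back into
    \<open>V\<close>.\<close>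
  have "\<exists>g\<in>F. g \<otimes>\<^bsub>?G\<^esub> s \<in> {S \<in> carrier ?G. S x \<in> V}" if s: "s \<in> carrier ?G" for s
  proof -
    have "s x \<in> Y"
      using system_group_image_invariant[OF sys s YX inv] \<open>x \<in> Y\<close> by blast
    then obtain g where g: "g \<in> F" "g (s x) \<in> W" using F(3) by blast
    then have "g \<in> carrier ?G" using F(2) by blast
    moreover from this have "g (s x) \<in> V"
      using WV g(2) system_group_in_space[OF sys] \<open>s x \<in> Y\<close> YX by blast
    ultimately show ?thesis
      using g(1) system_group_mult[OF sys _ s] \<open>x \<in> X\<close> by (intro bexI[of _ g]) (auto simp: compose_def)
  qed
  moreover have "F \<noteq> {}" using F(3) \<open>x \<in> Y\<close> by blast
  ultimately show "syndetic ?G {S \<in> carrier ?G. S x \<in> V}"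
    unfolding syndetic_def using F(1,2) by (intro conjI exI[of _ F]) blast+
qed

lemma recurrent_imp_minimal_subsystem:
  assumes sys: "rational_dynamical_system X l T \<T>" and rec: "uniformly_rational_recurrent X l T x"
  shows "minimal_subsystem (closure (system_orbit X l T x)) X l T \<T>"
proof -
  let ?G = "system_group X l T" and ?O = "system_orbit X l T x"
  have "x \<in> X" using rec by (simp add: uniformly_rational_recurrent_def)
  have clX: "closed X" using rational_dynamical_systemD(2)[OF sys] compact_imp_closed by blast
  have "Z = closure ?O" if "Z \<subseteq> closure ?O" and "subsystem Z X l T" for Z
  proof -
    have ZX: "Z \<subseteq> X" and "Z \<noteq> {}" and "closedin (top_of_set X) Z"
      and inv: "\<And>i n. i \<in> {1..l} \<Longrightarrow> n \<in> nonzero_ints \<Longrightarrow> T i n ` Z = Z"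
      using \<open>subsystem Z X l T\<close> closedin_imp_subset unfolding subsystem_def by auto
    then have "closed Z"
      using clX closedin_closed_trans by blast
    \<comment> \<open>This is the crux: a closed invariant set containing \<open>x\<close> contains
      the whole orbit closure.\<close>
    have "x \<in> Z"
    proof (rule ccontr)
      assume "x \<notin> Z"
      then obtain e where "e > 0" and e: "cball x e \<subseteq> - Z"
        using \<open>closed Z\<close> open_contains_cball[of "- Z"] by (auto simp: open_closed)
      \<comment> \<open>The neighbourhood used is the closed ball, with the open ball as the open
        set inside it. A closed neighbourhood makes the preimages below closed, so that their finite
        union contains the closure of the orbit too.\<close>
      then have "openin (top_of_set X) (X \<inter> ball x e)" "x \<in> X \<inter> ball x e" "X \<inter> ball x e \<subseteq> X \<inter> cball x e"
        using \<open>x \<in> X\<close> by auto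
      then have "syndetic ?G {S \<in> carrier ?G. S x \<in> X \<inter> cball x e}"
        using rec unfolding uniformly_rational_recurrent_def by blast
      then obtain F where "finite F" and FG: "F \<subseteq> carrier ?G"
        and F: "carrier ?G = (\<Union>g\<in>F. {s \<in> carrier ?G. g \<otimes>\<^bsub>?G\<^esub> s \<in> {S \<in> carrier ?G. S x \<in> X \<inter> cball x e}})"
        unfolding syndetic_def by blast
      have "?O \<subseteq> (\<Union>g\<in>F. X \<inter> g -` cball x e)"
      proof
        fix y assume "y \<in> ?O"
        then obtain s where s: "s \<in> carrier ?G" "y = s x" unfolding system_orbit_def by blast
        then obtain g where "g \<in> F" "(g \<otimes>\<^bsub>?G\<^esub> s) x \<in> cball x e" using F by blast
        moreover have "(g \<otimes>\<^bsub>?G\<^esub> s) x = g y"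
          using system_group_mult(1)[OF sys _ s(1)] FG \<open>g \<in> F\<close> \<open>x \<in> X\<close> s(2) by (auto simp: compose_def)
        moreover have "y \<in> X" using system_group_in_space[OF sys s(1)] s(2) \<open>x \<in> X\<close> by blast
        ultimately show "y \<in> (\<Union>g\<in>F. X \<inter> g -` cball x e)" by auto
      qed
      moreover have "closed (X \<inter> g -` cball x e)" if "g \<in> F" for g
        using system_group_continuous_on[OF sys] FG that clX by (blast intro: continuous_closed_preimage)
      ultimately have "closure ?O \<subseteq> (\<Union>g\<in>F. X \<inter> g -` cball x e)"
        using \<open>finite F\<close> by (intro closure_minimal closed_UN) auto
      moreover obtain z where "z \<in> Z" using \<open>Z \<noteq> {}\<close> by blast
      ultimately obtain g where "g \<in> F" "g z \<in> cball x e"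
        using \<open>Z \<subseteq> closure ?O\<close> by blast
      \<comment> \<open>Invariance keeps \<open>g z\<close> in \<open>Z\<close>, whereas the
        covering puts it into the ball chosen disjoint from \<open>Z\<close>.\<close>
      moreover have "g z \<in> Z"
        using system_group_image_invariant[OF sys _ ZX inv] FG \<open>g \<in> F\<close> \<open>z \<in> Z\<close> by blast
      ultimately show False using e by blast
    qed
    then have "closure ?O \<subseteq> Z"
      using system_orbit_subset[OF sys ZX inv] \<open>closed Z\<close> by (simp add: closure_minimal)
    then show ?thesis using \<open>Z \<subseteq> closure ?O\<close> by blast
  qed
  then show ?thesis
    using subsystem_orbit_closure[OF sys \<open>x \<in> X\<close>] minimal_subsystem_iff[OF sys] by blast
qed

theorem theorem2p12:
  fixes X Y :: "'a::metric_space set" and l :: nat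
    and T :: "nat \<Rightarrow> int \<Rightarrow> 'a \<Rightarrow> 'a" and \<T> :: "nat \<Rightarrow> rat \<Rightarrow> 'a \<Rightarrow> 'a"
  assumes "rational_dynamical_system X l T \<T>"
    and "Y \<subseteq> X"
  shows "minimal_subsystem Y X l T \<T> \<longleftrightarrow>
    (\<exists>x. uniformly_rational_recurrent X l T x \<and>
         Y = closure {S x | S. S \<in> carrier (system_group X l T)})"
  unfolding system_orbit_def[symmetric]
proof
  assume min: "minimal_subsystem Y X l T \<T>"
  \<comment> \<open>Any point of \<open>Y\<close> serves: each is uniformly recurrent and has
    \<open>Y\<close> as its orbit closure.\<close>
  then obtain x where "x \<in> Y"
    unfolding minimal_subsystem_def subsystem_def by blast
  then show "\<exists>x. uniformly_rational_recurrent X l T x \<and> Y = closure (system_orbit X l T x)"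
    using minimal_subsystem_imp_recurrent[OF assms(1) min]
      minimal_subsystem_orbit_closure[OF assms(1) min] by blast
qed (use recurrent_imp_minimal_subsystem[OF assms(1)] in blast)

end
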